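(* Let $X$ be a first countable $T_0$ space. Then the well-filterification of $X$ agrees with the sobrification of $X$.
   Context: A space is first countable if each point has a countable neighbourhood basis. For a $T_0$ space $X$, the lower Vietoris topology on a family of closed sets has as subbasis the sets $\diamondsuit U=\{A: A\cap U\neq\emptyset\}$, $U$ open in $X$. The sobrification of $X$ is the set $\mathbf{IRR}(X)$ of (nonempty) irreducible closed subsets of $X$ with the lower Vietoris topology, with embedding $x\mapsto cl(\{x\})$. A set is saturated if it is an intersection of open sets. A space is well-filtered if for each filtered family $\mathcal C$ (nonempty, any two members contain a common member) of compact saturated sets and each open $U$ with $\bigcap\mathcal C\subseteq U$ there is $K\in\mathcal C$ with $K\subseteq U$. A subset $A$ of a $T_0$ space $X$ is a $WD$-set if for every continuous $f:X\to Y$ into a well-filtered ($T_0$) space $Y$ there is a unique $y_A\in Y$ with $cl(f(A))=cl(\{y_A\})$; $\mathbf{WD}(X)$ is the set of closed $WD$-sets. The well-filterification (well-filtered reflection) of $X$ is $\mathbf{WD}(X)$ with the lower Vietoris topology and the map $x\mapsto cl(\{x\})$; it is contained in $\mathbf{IRR}(X)$. "Agrees" means $\mathbf{WD}(X)=\mathbf{IRR}(X)$. *)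

theory Defs
  imports "HOL-Analysis.Analysis"
begin

definition saturatedin :: "'a topology \<Rightarrow> 'a set \<Rightarrow> bool" where
  "saturatedin X S \<longleftrightarrow> (\<exists>\<U>. (\<forall>U\<in>\<U>. openin X U) \<and> S = topspace X \<inter> \<Inter>\<U>)"

definition filtered_family :: "'a set set \<Rightarrow> bool" where
  "filtered_family \<C> \<longleftrightarrow> \<C> \<noteq> {} \<and> (\<forall>K\<in>\<C>. \<forall>L\<in>\<C>. \<exists>M\<in>\<C>. M \<subseteq> K \<inter> L)"

definition well_filtered_space :: "'a topology \<Rightarrow> bool" where
  "well_filtered_space X \<longleftrightarrow>
     (\<forall>\<C> U. filtered_family \<C> \<and> (\<forall>K\<in>\<C>. compactin X K \<and> saturatedin X K) \<and>
        openin X U \<and> \<Inter>\<C> \<subseteq> U \<longrightarrow> (\<exists>K\<in>\<C>. K \<subseteq> U))"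

definition irreduciblein :: "'a topology \<Rightarrow> 'a set \<Rightarrow> bool" where
  "irreduciblein X A \<longleftrightarrow> A \<subseteq> topspace X \<and> A \<noteq> {} \<and>
     (\<forall>B C. closedin X B \<and> closedin X C \<and> A \<subseteq> B \<union> C \<longrightarrow> A \<subseteq> B \<or> A \<subseteq> C)"

definition irr_closed_sets :: "'a topology \<Rightarrow> 'a set set" where
  "irr_closed_sets X = {A. closedin X A \<and> irreduciblein X A}"

definition vietoris_diamond :: "'a set set \<Rightarrow> 'a set \<Rightarrow> 'a set set" where
  "vietoris_diamond \<F> U = {A \<in> \<F>. A \<inter> U \<noteq> {}}"

definition lower_vietoris :: "'a topology \<Rightarrow> 'a set set \<Rightarrow> 'a set topology" where
  "lower_vietoris X \<F> = topology (arbitrary union_of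
     (finite intersection_of (\<lambda>\<D>. \<exists>U. openin X U \<and> \<D> = vietoris_diamond \<F> U) relative_to \<F>))"

definition sobrification :: "'a topology \<Rightarrow> 'a set topology" where
  "sobrification X = lower_vietoris X (irr_closed_sets X)"

text \<open>
  A WD-set is tested against all well-filtered spaces. A definition in HOL cannot quantify
  over the types carrying those spaces, so the carrier type of the test spaces is first made
  an explicit parameter. Test spaces carried by the type \<open>'a set\<close> suffice: the lemma
  \<open>wd_set_imp_wd_set_at\<close> below shows that a set passing these tests passes the tests against
  well-filtered spaces over an arbitrary type \<open>'b\<close>.
\<close>

definition wd_set_at :: "'b itself \<Rightarrow> 'a topology \<Rightarrow> 'a set \<Rightarrow> bool" where
  "wd_set_at _ X A \<longleftrightarrow> A \<subseteq> topspace X \<and>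
     (\<forall>(Y :: 'b topology) f. t0_space Y \<and> well_filtered_space Y \<and> continuous_map X Y f \<longrightarrow>
        (\<exists>!y. y \<in> topspace Y \<and> Y closure_of (f ` A) = Y closure_of {y}))"

definition wd_set :: "'a topology \<Rightarrow> 'a set \<Rightarrow> bool" where
  "wd_set X A \<longleftrightarrow> wd_set_at TYPE('a set) X A"

definition closed_wd_sets :: "'a topology \<Rightarrow> 'a set set" where
  "closed_wd_sets X = {A. closedin X A \<and> wd_set X A}"

definition well_filterification :: "'a topology \<Rightarrow> 'a set topology" where
  "well_filterification X = lower_vietoris X (closed_wd_sets X)"


subsection \<open>Independence of the carrier type of the test spaces\<close>

lemma irreducibleinD:
  assumes "irreduciblein X A" "closedin X B" "closedin X C" "A \<subseteq> B \<union> C"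
  shows "A \<subseteq> B \<or> A \<subseteq> C"
  using assms unfolding irreduciblein_def by simp

lemma well_filtered_spaceD:
  assumes "well_filtered_space X" "filtered_family \<C>"
    and "\<And>K. K \<in> \<C> \<Longrightarrow> compactin X K \<and> saturatedin X K"
    and "openin X U" "\<Inter>\<C> \<subseteq> U"
  shows "\<exists>K\<in>\<C>. K \<subseteq> U"
  using assms unfolding well_filtered_space_def by simp

lemma topspace_lower_vietoris [simp]: "topspace (lower_vietoris X \<F>) = \<F>"
  by (simp add: lower_vietoris_def)

lemma openin_lower_vietoris_diamond:
  assumes "openin X U" shows "openin (lower_vietoris X \<F>) (vietoris_diamond \<F> U)"
proof -
  have "(finite intersection_of (\<lambda>\<D>. \<exists>U. openin X U \<and> \<D> = vietoris_diamond \<F> U)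
      relative_to \<F>) (\<F> \<inter> vietoris_diamond \<F> U)"
    by (rule relative_to_inc[OF finite_intersection_of_inc]) (use assms in blast)
  moreover have "\<F> \<inter> vietoris_diamond \<F> U = vietoris_diamond \<F> U"
    by (auto simp: vietoris_diamond_def)
  ultimately show ?thesis
    unfolding lower_vietoris_def openin_subbase by (simp add: arbitrary_union_of_inc)
qed

lemma irr_meets_Int:
  assumes A: "A \<in> irr_closed_sets X" and U: "openin X U" and V: "openin X V"
    and "A \<inter> U \<noteq> {}" "A \<inter> V \<noteq> {}"
  shows "A \<inter> (U \<inter> V) \<noteq> {}"
proof
  assume "A \<inter> (U \<inter> V) = {}"
  then have "A \<subseteq> (topspace X - U) \<union> (topspace X - V)"
    using A by (auto simp: irr_closed_sets_def irreduciblein_def)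
  moreover have "irreduciblein X A" using A by (simp add: irr_closed_sets_def)
  ultimately have "A \<subseteq> topspace X - U \<or> A \<subseteq> topspace X - V"
    using U V by (intro irreducibleinD) auto
  with assms show False by blast
qed

lemma openin_lower_vietoris_irr:
  assumes F: "\<F> \<subseteq> irr_closed_sets X"
  shows "openin (lower_vietoris X \<F>) \<D> \<longleftrightarrow> (\<exists>U. openin X U \<and> \<D> = vietoris_diamond \<F> U)"
    (is "_ = ?R \<D>")
proof
  assume "?R \<D>" then show "openin (lower_vietoris X \<F>) \<D>"
    using openin_lower_vietoris_diamond by blast
next
  have top: "vietoris_diamond \<F> (topspace X) = \<F>"
  proof -
    have "B \<subseteq> topspace X \<and> B \<noteq> {}" if "B \<in> \<F>" for B
      using F that unfolding irr_closed_sets_def irreduciblein_def by blast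
    then show ?thesis unfolding vietoris_diamond_def by blast
  qed
  have I: "?R (\<A> \<inter> \<B>)" if "?R \<A>" "?R \<B>" for \<A> \<B>
  proof -
    obtain U V where U: "openin X U" "\<A> = vietoris_diamond \<F> U"
      and V: "openin X V" "\<B> = vietoris_diamond \<F> V" using \<open>?R \<A>\<close> \<open>?R \<B>\<close> by blast
    have "vietoris_diamond \<F> U \<inter> vietoris_diamond \<F> V = vietoris_diamond \<F> (U \<inter> V)"
      using irr_meets_Int[OF _ U(1) V(1)] F unfolding vietoris_diamond_def by blast
    then show ?thesis using U V by blast
  qed
  have T: "istopology ?R"
    unfolding istopology_def
  proof (intro conjI allI impI)
    fix \<K> assume K: "\<forall>K\<in>\<K>. ?R K"
    define \<U> where "\<U> = {U. openin X U \<and> vietoris_diamond \<F> U \<in> \<K>}"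
    have "\<K> = vietoris_diamond \<F> ` \<U>"
      using K by (auto simp: \<U>_def)
    moreover have "\<Union>(vietoris_diamond \<F> ` \<U>) = vietoris_diamond \<F> (\<Union>\<U>)"
      by (auto simp: vietoris_diamond_def)
    moreover have "openin X (\<Union>\<U>)" by (auto simp: \<U>_def)
    ultimately show "?R (\<Union>\<K>)" by metis
  qed (rule I)
  then have o: "openin (topology ?R) = ?R" by (simp add: topology_inverse')
  assume "openin (lower_vietoris X \<F>) \<D>"
  then have "openin (topology ?R) \<D>"
    unfolding lower_vietoris_def
  proof (rule minimal_topology_subbase[rotated 2])
    show "openin (topology ?R) \<F>" unfolding o using top by blast
  qed (simp add: o)
  then show "?R \<D>" by (simp add: o)
qed

lemma closure_of_sing_irr:
  assumes "x \<in> topspace X" shows "X closure_of {x} \<in> irr_closed_sets X"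
  unfolding irr_closed_sets_def irreduciblein_def
proof (intro CollectI conjI allI impI)
  have x: "x \<in> X closure_of {x}" using assms by (simp add: in_closure_of)
  then show "X closure_of {x} \<noteq> {}" by blast
  fix B C assume "closedin X B \<and> closedin X C \<and> X closure_of {x} \<subseteq> B \<union> C"
  then show "X closure_of {x} \<subseteq> B \<or> X closure_of {x} \<subseteq> C"
    using x by (meson Un_iff closure_of_minimal empty_subsetI insert_subset subsetD)
qed (simp_all add: closure_of_subset_topspace)

lemma closure_of_eq_iff_meets:
  assumes A: "A \<subseteq> topspace X" and C: "C \<subseteq> topspace X"
  shows "X closure_of A = X closure_of C \<longleftrightarrow>
    (\<forall>V. openin X V \<longrightarrow> (A \<inter> V \<noteq> {} \<longleftrightarrow> C \<inter> V \<noteq> {}))"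
proof -
  have *: "X closure_of S \<subseteq> X closure_of T \<longleftrightarrow>
      (\<forall>V. openin X V \<and> S \<inter> V \<noteq> {} \<longrightarrow> T \<inter> V \<noteq> {})" if S: "S \<subseteq> topspace X" for S T
  proof -
    have "X closure_of S \<subseteq> X closure_of T \<longleftrightarrow> S \<subseteq> X closure_of T"
      by (metis S closedin_closure_of closure_of_minimal closure_of_subset subset_trans)
    also have "\<dots> \<longleftrightarrow> (\<forall>V. openin X V \<and> S \<inter> V \<noteq> {} \<longrightarrow> T \<inter> V \<noteq> {})"
      using S unfolding closure_of_def by blast
    finally show ?thesis .
  qed
  show ?thesis
    unfolding set_eq_subset[of "X closure_of A"] *[OF A] *[OF C] by blast
qed

lemma closure_of_eq_meets:
  assumes "X closure_of A = X closure_of C" "openin X V"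
    and "A \<subseteq> topspace X" "C \<subseteq> topspace X"
  shows "A \<inter> V \<noteq> {} \<longleftrightarrow> C \<inter> V \<noteq> {}"
  using closure_of_eq_iff_meets[OF assms(3,4)] assms(1,2) by simp

text \<open>
  Given a continuous map \<open>f\<close> from \<open>X\<close> into a well-filtered space \<open>Y\<close>, the irreducible closed
  sets whose image has the closure of a point again form a well-filtered space. It is carried
  by \<open>'a set\<close> and serves as a test space in place of \<open>Y\<close>.
\<close>

lemma well_filtered_test_space:
  fixes X :: "'a topology" and Y :: "'b topology"
  assumes wf: "well_filtered_space Y" and f: "continuous_map X Y f"
  defines "\<Z> \<equiv> {B \<in> irr_closed_sets X. \<exists>y\<in>topspace Y. Y closure_of (f ` B) = Y closure_of {y}}"
  shows "well_filtered_space (lower_vietoris X \<Z>)"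
proof -
  define Z where "Z = lower_vietoris X \<Z>"
  have Zirr: "\<Z> \<subseteq> irr_closed_sets X" by (auto simp: \<Z>_def)
  have topZ: "topspace Z = \<Z>" by (simp add: Z_def)
  have opZ: "openin Z \<D> \<longleftrightarrow> (\<exists>U. openin X U \<and> \<D> = vietoris_diamond \<Z> U)" for \<D>
    unfolding Z_def by (rule openin_lower_vietoris_irr[OF Zirr])
  have Zsub: "B \<subseteq> topspace X" if "B \<in> \<Z>" for B
    using that Zirr by (auto simp: irr_closed_sets_def irreduciblein_def)
  have fsub: "f ` B \<subseteq> topspace Y" if "B \<subseteq> topspace X" for B
    using that f by (auto simp: continuous_map_def)
  obtain p where p: "\<And>B. B \<in> \<Z> \<Longrightarrow> p B \<in> topspace Y"
    "\<And>B. B \<in> \<Z> \<Longrightarrow> Y closure_of (f ` B) = Y closure_of {p B}"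
  proof -
    have "\<forall>B\<in>\<Z>. \<exists>y. y \<in> topspace Y \<and> Y closure_of (f ` B) = Y closure_of {y}"
      unfolding \<Z>_def by blast
    then show ?thesis using that by (metis (no_types))
  qed
  define P where "P V = {x \<in> topspace X. f x \<in> V}" for V
  have Pop: "openin X (P V)" if "openin Y V" for V
    using f that by (simp add: P_def continuous_map_def)
  have pV: "p B \<in> V \<longleftrightarrow> B \<inter> P V \<noteq> {}" if "B \<in> \<Z>" "openin Y V" for B V
  proof -
    have "f ` B \<inter> V \<noteq> {} \<longleftrightarrow> {p B} \<inter> V \<noteq> {}"
      by (rule closure_of_eq_meets[OF p(2)[OF that(1)] that(2) fsub[OF Zsub[OF that(1)]]])
        (use p(1)[OF that(1)] in simp)
    then show ?thesis using Zsub[OF that(1)] unfolding P_def by blast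
  qed
  have pcont: "continuous_map Z Y p"
    unfolding continuous_map_def
  proof (intro conjI allI impI)
    show "p \<in> topspace Z \<rightarrow> topspace Y" using p topZ by blast
    fix V assume V: "openin Y V"
    have "{B \<in> topspace Z. p B \<in> V} = vietoris_diamond \<Z> (P V)"
      using pV[OF _ V] by (auto simp: topZ vietoris_diamond_def)
    then show "openin Z {B \<in> topspace Z. p B \<in> V}" using opZ Pop[OF V] by blast
  qed
  have "\<exists>K\<in>\<K>. K \<subseteq> \<D>"
    if fil: "filtered_family \<K>" and K: "\<And>K. K \<in> \<K> \<Longrightarrow> compactin Z K \<and> saturatedin Z K"
      and D: "openin Z \<D>" and sub: "\<Inter>\<K> \<subseteq> \<D>" for \<K> \<D>
  proof (rule ccontr)
    assume no: "\<not> (\<exists>K\<in>\<K>. K \<subseteq> \<D>)"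
    have KZ: "K \<subseteq> \<Z>" if "K \<in> \<K>" for K
      using K[OF that] compactin_subset_topspace topZ by blast
    have Kne: "\<K> \<noteq> {}" and Kdir: "\<And>K L. K \<in> \<K> \<Longrightarrow> L \<in> \<K> \<Longrightarrow> \<exists>M\<in>\<K>. M \<subseteq> K \<inter> L"
      using fil by (auto simp: filtered_family_def)
    obtain U where U: "openin X U" "\<D> = vietoris_diamond \<Z> U" using D opZ by blast
    define good where "good C \<longleftrightarrow> closedin X C \<and> C \<inter> U = {} \<and> (\<forall>K\<in>\<K>. \<exists>B\<in>K. B \<subseteq> C)" for C
    have "good (topspace X - U)"
      unfolding good_def
    proof (intro conjI ballI)
      fix K assume "K \<in> \<K>"
      then obtain B where "B \<in> K" "B \<notin> \<D>" using no by blast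
      then have "B \<subseteq> topspace X - U"
        using Zsub KZ[OF \<open>K \<in> \<K>\<close>] by (auto simp: U vietoris_diamond_def)
      then show "\<exists>B\<in>K. B \<subseteq> topspace X - U" using \<open>B \<in> K\<close> by blast
    qed (use U in auto)
    then have ne_good: "uminus ` {C. good C} \<noteq> {}" by blast
    have good_Inter: "good (\<Inter>\<C>)" if ch: "subset.chain {C. good C} \<C>" and ne: "\<C> \<noteq> {}" for \<C>
      unfolding good_def
    proof (intro conjI ballI)
      have g: "good C" if "C \<in> \<C>" for C using ch that by (auto simp: subset.chain_def)
      show "closedin X (\<Inter>\<C>)" using g ne by (auto simp: good_def)
      show "\<Inter>\<C> \<inter> U = {}" using g ne by (auto simp: good_def)
      fix K assume KK: "K \<in> \<K>"
      show "\<exists>B\<in>K. B \<subseteq> \<Inter>\<C>"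
      proof (rule ccontr)
        assume none: "\<not> (\<exists>B\<in>K. B \<subseteq> \<Inter>\<C>)"
        let ?\<U> = "(\<lambda>C. vietoris_diamond \<Z> (topspace X - C)) ` \<C>"
        have "\<forall>D\<in>?\<U>. openin Z D"
          using g opZ by (auto simp: good_def)
        moreover have "K \<subseteq> \<Union>?\<U>"
        proof
          fix B assume "B \<in> K"
          then obtain C where "C \<in> \<C>" "\<not> B \<subseteq> C" using none by blast
          then show "B \<in> \<Union>?\<U>"
            using Zsub KZ[OF KK] \<open>B \<in> K\<close> by (force simp: vietoris_diamond_def)
        qed
        ultimately obtain \<F> where \<F>: "finite \<F>" "\<F> \<subseteq> ?\<U>" "K \<subseteq> \<Union>\<F>"
          using K[OF KK] unfolding compactin_def by meson
        then obtain \<C>' where C': "finite \<C>'" "\<C>' \<subseteq> \<C>"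
          "\<F> = (\<lambda>C. vietoris_diamond \<Z> (topspace X - C)) ` \<C>'"
          by (metis finite_subset_image)
        have "K \<noteq> {}" using no KK by blast
        then have "\<C>' \<noteq> {}" using \<F> C' by auto
        have "subset.chain {C. good C} \<C>'"
          using ch C'(2) unfolding subset.chain_def by blast
        then have "\<Inter>\<C>' \<in> \<C>'"
          by (rule Inter_in_chain[OF C'(1) \<open>\<C>' \<noteq> {}\<close>])
        then have "good (\<Inter>\<C>')" using g C'(2) by blast
        then obtain B where B: "B \<in> K" "B \<subseteq> \<Inter>\<C>'" using KK unfolding good_def by blast
        then obtain D where "D \<in> \<C>'" "B \<in> vietoris_diamond \<Z> (topspace X - D)"
          using \<F>(3) C'(3) by blast
        then show False using B(2) unfolding vietoris_diamond_def by blast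
      qed
    qed
    have "\<exists>M\<in>uminus ` {C. good C}. \<forall>N\<in>uminus ` {C. good C}. M \<subseteq> N \<longrightarrow> N = M"
    proof (rule subset_Zorn_nonempty[OF ne_good])
      fix \<M> assume M: "\<M> \<noteq> {}" "subset.chain (uminus ` {C. good C}) \<M>"
      have "subset.chain {C. good C} (uminus ` \<M>)"
        using M(2) unfolding subset_chain_def by fastforce
      then have "good (\<Inter>(uminus ` \<M>))" using good_Inter M(1) by blast
      moreover have "\<Union>\<M> = - \<Inter>(uminus ` \<M>)" by auto
      ultimately show "\<Union>\<M> \<in> uminus ` {C. good C}" by blast
    qed
    then obtain M where M: "M \<in> uminus ` {C. good C}"
      and Mmax: "\<forall>N\<in>uminus ` {C. good C}. M \<subseteq> N \<longrightarrow> N = M" by (rule bexE)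
    from M obtain C where MC: "M = - C" and C: "good C" by (elim imageE CollectE)
    have Cmin: "C' = C" if "good C'" "C' \<subseteq> C" for C'
    proof -
      have "- C' = M" using Mmax that MC by simp
      then show ?thesis using MC by simp
    qed
    have Ccl: "closedin X C" and CU: "C \<inter> U = {}" and CK: "\<And>K. K \<in> \<K> \<Longrightarrow> \<exists>B\<in>K. B \<subseteq> C"
      using C by (auto simp: good_def)
    have Ctop: "C \<subseteq> topspace X" using Ccl closedin_subset by blast
    have Birr: "irreduciblein X B" if "B \<in> K" "K \<in> \<K>" for B K
      using that KZ Zirr by (auto simp: irr_closed_sets_def)
    have miss: "\<exists>K\<in>\<K>. \<forall>B\<in>K. B \<subseteq> C \<longrightarrow> \<not> B \<subseteq> D" if "closedin X D" "\<not> C \<subseteq> D" for D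
    proof (rule ccontr)
      assume "\<not> ?thesis"
      then have "good (C \<inter> D)"
        using that(1) Ccl CU unfolding good_def by auto
      then show False using Cmin[of "C \<inter> D"] that(2) by blast
    qed
    have Cirr: "C \<in> irr_closed_sets X"
      unfolding irr_closed_sets_def irreduciblein_def
    proof (intro CollectI conjI allI impI)
      show "C \<noteq> {}"
      proof -
        obtain K where "K \<in> \<K>" using Kne by blast
        moreover obtain B where "B \<in> K" "B \<subseteq> C" using CK[OF \<open>K \<in> \<K>\<close>] by blast
        ultimately have "irreduciblein X B" using Birr by simp
        then have "B \<noteq> {}" by (simp add: irreduciblein_def)
        then show ?thesis using \<open>B \<subseteq> C\<close> by blast
      qed
      fix D E assume DE: "closedin X D \<and> closedin X E \<and> C \<subseteq> D \<union> E"
      show "C \<subseteq> D \<or> C \<subseteq> E"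
      proof (rule ccontr)
        assume "\<not> ?thesis"
        then obtain K L where K: "K \<in> \<K>" "\<forall>B\<in>K. B \<subseteq> C \<longrightarrow> \<not> B \<subseteq> D"
          and L: "L \<in> \<K>" "\<forall>B\<in>L. B \<subseteq> C \<longrightarrow> \<not> B \<subseteq> E"
          using miss[of D] miss[of E] DE by metis
        obtain M where M: "M \<in> \<K>" "M \<subseteq> K \<inter> L" using Kdir K L by blast
        obtain B where B: "B \<in> M" "B \<subseteq> C" using CK M by blast
        have "B \<subseteq> D \<or> B \<subseteq> E"
          by (rule irreducibleinD[OF Birr[OF B(1) M(1)]]) (use DE B(2) in auto)
        then show False using K L M B by blast
      qed
    qed (use Ccl Ctop in auto)
    define up where "up S = {y \<in> topspace Y. \<exists>s\<in>S. \<forall>V. openin Y V \<and> s \<in> V \<longrightarrow> y \<in> V}" for S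
    have up_inc: "S \<subseteq> up S" if "S \<subseteq> topspace Y" for S using that by (auto simp: up_def)
    have up_comp: "compactin Y (up S)" if S: "compactin Y S" for S
      unfolding compactin_def
    proof (intro conjI allI impI)
      show "up S \<subseteq> topspace Y" by (auto simp: up_def)
      have St: "S \<subseteq> topspace Y" using S compactin_subset_topspace by blast
      fix \<U> assume \<U>: "Ball \<U> (openin Y) \<and> up S \<subseteq> \<Union>\<U>"
      then have "S \<subseteq> \<Union>\<U>" using up_inc[OF St] by blast
      then obtain \<F> where F: "finite \<F>" "\<F> \<subseteq> \<U>" "S \<subseteq> \<Union>\<F>"
        using S \<U> unfolding compactin_def by meson
      have "up S \<subseteq> \<Union>\<F>"
      proof
        fix y assume "y \<in> up S"
        then obtain s where s: "s \<in> S" "\<forall>V. openin Y V \<and> s \<in> V \<longrightarrow> y \<in> V"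
          unfolding up_def by blast
        then obtain V where V: "V \<in> \<F>" "s \<in> V" using F(3) by blast
        then have "openin Y V" using \<U> F(2) by blast
        then show "y \<in> \<Union>\<F>" using s(2) V by blast
      qed
      then show "\<exists>\<F>. finite \<F> \<and> \<F> \<subseteq> \<U> \<and> up S \<subseteq> \<Union>\<F>" using F by blast
    qed
    have up_sat: "saturatedin Y (up S)" if St: "S \<subseteq> topspace Y" for S
      unfolding saturatedin_def
    proof (intro exI conjI)
      let ?\<U> = "{V. openin Y V \<and> S \<subseteq> V}"
      show "\<forall>V\<in>?\<U>. openin Y V" by blast
      show "up S = topspace Y \<inter> \<Inter>?\<U>"
      proof
        show "up S \<subseteq> topspace Y \<inter> \<Inter>?\<U>" by (auto simp: up_def)
        show "topspace Y \<inter> \<Inter>?\<U> \<subseteq> up S"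
        proof (rule ccontr)
          assume "\<not> ?thesis"
          then obtain y where y: "y \<in> topspace Y" "y \<in> \<Inter>?\<U>" "y \<notin> up S" by blast
          then have "\<forall>s\<in>S. \<exists>V. openin Y V \<and> s \<in> V \<and> y \<notin> V" unfolding up_def by blast
          then have "openin Y (\<Union>{V. openin Y V \<and> y \<notin> V})" "S \<subseteq> \<Union>{V. openin Y V \<and> y \<notin> V}"
            by blast+
          then show False using y(2) by blast
        qed
      qed
    qed
    define T where "T K = {B \<in> K. B \<subseteq> C}" for K
    define H where "H K = up (p ` T K)" for K
    have Tcomp: "compactin Z (T K)" if "K \<in> \<K>" for K
    proof -
      have "openin Z (vietoris_diamond \<Z> (topspace X - C))"
        using opZ openin_diff[OF openin_topspace Ccl] by blast
      then have "closedin Z (\<Z> - vietoris_diamond \<Z> (topspace X - C))"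
        using closedin_diff[OF closedin_topspace] topZ by metis
      moreover have "T K = K \<inter> (\<Z> - vietoris_diamond \<Z> (topspace X - C))"
        using KZ[OF that] Zsub by (force simp: T_def vietoris_diamond_def)
      ultimately show ?thesis using K[OF that] by (metis compact_Int_closedin)
    qed
    have pT: "p ` T K \<subseteq> topspace Y" if "K \<in> \<K>" for K
      using KZ[OF that] p(1) by (auto simp: T_def)
    have Hcomp: "compactin Y (H K) \<and> saturatedin Y (H K)" if "K \<in> \<K>" for K
      unfolding H_def
      by (intro conjI up_comp up_sat pT[OF that] image_compactin[OF Tcomp[OF that] pcont])
    have Hfil: "filtered_family (H ` \<K>)"
      unfolding filtered_family_def
    proof (intro conjI ballI)
      show "H ` \<K> \<noteq> {}" using Kne by blast
      fix A B assume "A \<in> H ` \<K>" "B \<in> H ` \<K>"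
      then obtain K L where KL: "K \<in> \<K>" "L \<in> \<K>" "A = H K" "B = H L" by blast
      then obtain M where M: "M \<in> \<K>" "M \<subseteq> K \<inter> L" using Kdir by blast
      have "H M \<subseteq> H K \<inter> H L" using M(2) unfolding H_def T_def up_def by blast
      then show "\<exists>M\<in>H ` \<K>. M \<subseteq> A \<inter> B" using M KL by blast
    qed
    have "\<not> \<Inter>(H ` \<K>) \<subseteq> topspace Y - Y closure_of (f ` C)"
    proof
      assume sub: "\<Inter>(H ` \<K>) \<subseteq> topspace Y - Y closure_of (f ` C)"
      have "\<exists>A\<in>H ` \<K>. A \<subseteq> topspace Y - Y closure_of (f ` C)"
      proof (rule well_filtered_spaceD[OF wf Hfil _ _ sub])
        show "compactin Y A \<and> saturatedin Y A" if "A \<in> H ` \<K>" for A using that Hcomp by blast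
        show "openin Y (topspace Y - Y closure_of (f ` C))" by (simp add: openin_diff)
      qed
      then obtain K where KK: "K \<in> \<K>" "H K \<subseteq> topspace Y - Y closure_of (f ` C)" by blast
      obtain B where B: "B \<in> K" "B \<subseteq> C" using CK KK by blast
      have BZ: "B \<in> \<Z>" using B KK KZ by blast
      have "p B \<in> H K" using up_inc[OF pT[OF KK(1)]] B unfolding H_def T_def by blast
      moreover have "p B \<in> Y closure_of {p B}"
        using p(1)[OF BZ] by (simp add: in_closure_of)
      then have "p B \<in> Y closure_of (f ` C)"
        using p(2)[OF BZ] closure_of_mono[of "f ` B" "f ` C" Y] B(2) by blast
      ultimately show False using KK(2) by blast
    qed
    then obtain y where yI: "y \<in> \<Inter>(H ` \<K>)" and yn: "y \<notin> topspace Y - Y closure_of (f ` C)"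
      by (meson subsetI)
    have yH: "y \<in> H K" if "K \<in> \<K>" for K using yI that by (rule INT_D)
    obtain K0 where "K0 \<in> \<K>" using Kne by blast
    then have yY: "y \<in> topspace Y" using yH unfolding H_def up_def by blast
    have yC: "y \<in> Y closure_of (f ` C)" using yn yY by simp
    define D where "D = {x \<in> topspace X. f x \<in> Y closure_of {y}}"
    have Dcl: "closedin X D"
      unfolding D_def using f by (rule closedin_continuous_map_preimage) simp
    have "C \<subseteq> D"
    proof (rule ccontr)
      assume "\<not> C \<subseteq> D"
      then obtain K where KK: "K \<in> \<K>" "\<forall>B\<in>K. B \<subseteq> C \<longrightarrow> \<not> B \<subseteq> D" using miss[OF Dcl] by blast
      obtain B where B: "B \<in> T K" "\<forall>V. openin Y V \<and> p B \<in> V \<longrightarrow> y \<in> V"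
        using yH[OF KK(1)] unfolding H_def up_def by blast
      have BZ: "B \<in> \<Z>" using B KK(1) KZ unfolding T_def by blast
      have "p B \<in> Y closure_of {y}" using B(2) p(1)[OF BZ] by (simp add: in_closure_of)
      then have "Y closure_of {p B} \<subseteq> Y closure_of {y}" by (simp add: closure_of_minimal)
      then have "f ` B \<subseteq> Y closure_of {y}"
        using p(2)[OF BZ] closure_of_subset[OF fsub[OF Zsub[OF BZ]]] by blast
      then have "B \<subseteq> D" using Zsub[OF BZ] unfolding D_def by blast
      then show False using KK B unfolding T_def by blast
    qed
    then have "f ` C \<subseteq> Y closure_of {y}" unfolding D_def by blast
    then have "Y closure_of (f ` C) = Y closure_of {y}"
      using yC by (simp add: closure_of_minimal subset_antisym)
    then have CZ: "C \<in> \<Z>" using Cirr yY unfolding \<Z>_def by blast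
    have "C \<in> K" if KK: "K \<in> \<K>" for K
    proof -
      obtain \<U> where \<U>: "\<forall>D\<in>\<U>. openin Z D" "K = topspace Z \<inter> \<Inter>\<U>"
        using K[OF KK] unfolding saturatedin_def by blast
      obtain B where B: "B \<in> K" "B \<subseteq> C" using CK[OF KK] by blast
      have "C \<in> D" if "D \<in> \<U>" for D
      proof -
        obtain V where "D = vietoris_diamond \<Z> V" using \<U>(1) opZ \<open>D \<in> \<U>\<close> by blast
        moreover have "B \<in> D" using B \<U> that by blast
        ultimately show ?thesis using B(2) CZ by (auto simp: vietoris_diamond_def)
      qed
      then show ?thesis using \<U>(2) CZ topZ by blast
    qed
    then have "C \<in> \<D>" using sub by blast
    then show False using CU by (auto simp: U vietoris_diamond_def)
  qed
  then show ?thesis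
    unfolding well_filtered_space_def Z_def[symmetric] by simp
qed

lemma wd_set_imp_wd_set_at:
  fixes X :: "'a topology"
  assumes A: "wd_set X A"
  shows "wd_set_at TYPE('b) X A"
  unfolding wd_set_at_def
proof (intro conjI allI impI)
  show AX: "A \<subseteq> topspace X" using A by (simp add: wd_set_def wd_set_at_def)
  fix Y :: "'b topology" and f
  assume Y: "t0_space Y \<and> well_filtered_space Y \<and> continuous_map X Y f"
  then have f: "continuous_map X Y f" by blast
  define \<Z> where
    "\<Z> = {B \<in> irr_closed_sets X. \<exists>y\<in>topspace Y. Y closure_of (f ` B) = Y closure_of {y}}"
  define Z where "Z = lower_vietoris X \<Z>"
  define e where "e x = X closure_of {x}" for x
  have Zirr: "\<Z> \<subseteq> irr_closed_sets X" by (auto simp: \<Z>_def)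
  have topZ: "topspace Z = \<Z>" by (simp add: Z_def)
  have opZ: "openin Z \<D> \<longleftrightarrow> (\<exists>U. openin X U \<and> \<D> = vietoris_diamond \<Z> U)" for \<D>
    unfolding Z_def by (rule openin_lower_vietoris_irr[OF Zirr])
  have fin: "f x \<in> topspace Y" if "x \<in> topspace X" for x
    using f that by (auto simp: continuous_map_def)
  have cl_image: "Y closure_of (f ` (X closure_of S)) = Y closure_of (f ` S)"
    if "S \<subseteq> topspace X" for S
  proof
    show "Y closure_of (f ` (X closure_of S)) \<subseteq> Y closure_of (f ` S)"
      using f by (simp add: closure_of_minimal continuous_map_image_closure_subset)
    show "Y closure_of (f ` S) \<subseteq> Y closure_of (f ` (X closure_of S))"
      by (simp add: closure_of_mono closure_of_subset image_mono that)
  qed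
  have eZ: "e x \<in> \<Z>" if "x \<in> topspace X" for x
    using closure_of_sing_irr[OF that] cl_image[of "{x}"] fin[OF that] that
    unfolding \<Z>_def e_def by auto
  have e_meets: "e x \<inter> U \<noteq> {} \<longleftrightarrow> x \<in> U" if "x \<in> topspace X" "openin X U" for x U
    using that by (auto simp: e_def closure_of_def)
  have e: "continuous_map X Z e"
    unfolding continuous_map_def
  proof (intro conjI allI impI)
    show "e \<in> topspace X \<rightarrow> topspace Z" using eZ topZ by blast
    fix \<D> assume "openin Z \<D>"
    then obtain U where U: "openin X U" "\<D> = vietoris_diamond \<Z> U" using opZ by blast
    have "{x \<in> topspace X. e x \<in> \<D>} = U"
      using e_meets[OF _ U(1)] eZ openin_subset[OF U(1)] by (auto simp: U(2) vietoris_diamond_def)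
    then show "openin X {x \<in> topspace X. e x \<in> \<D>}" using U(1) by simp
  qed
  have "t0_space Z"
    unfolding t0_space_def topZ
  proof (intro ballI impI)
    fix B C assume BC: "B \<in> \<Z>" "C \<in> \<Z>" "B \<noteq> C"
    then have cl: "closedin X B" "closedin X C" using Zirr by (auto simp: irr_closed_sets_def)
    then have s: "B \<subseteq> topspace X" "C \<subseteq> topspace X" using closedin_subset by auto
    have o: "openin Z (vietoris_diamond \<Z> (topspace X - B))"
      "openin Z (vietoris_diamond \<Z> (topspace X - C))" using opZ cl by blast+
    have "\<not> C \<subseteq> B \<or> \<not> B \<subseteq> C" using BC(3) by blast
    then show "\<exists>U. openin Z U \<and> (B \<notin> U \<longleftrightarrow> C \<in> U)"
    proof
      assume "\<not> C \<subseteq> B"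
      then show ?thesis using o(1) BC s
        by (intro exI[of _ "vietoris_diamond \<Z> (topspace X - B)"]) (auto simp: vietoris_diamond_def)
    next
      assume "\<not> B \<subseteq> C"
      then show ?thesis using o(2) BC s
        by (intro exI[of _ "vietoris_diamond \<Z> (topspace X - C)"]) (auto simp: vietoris_diamond_def)
    qed
  qed
  moreover have "well_filtered_space Z"
    unfolding Z_def \<Z>_def using well_filtered_test_space[OF _ f] Y by blast
  ultimately obtain B where B: "B \<in> \<Z>" "Z closure_of (e ` A) = Z closure_of {B}"
    using A e unfolding wd_set_def wd_set_at_def topZ[symmetric] by meson
  have BX: "B \<subseteq> topspace X" and Bcl: "closedin X B"
    using B(1) Zirr by (auto simp: irr_closed_sets_def irreduciblein_def)
  have meets: "A \<inter> U \<noteq> {} \<longleftrightarrow> B \<inter> U \<noteq> {}" if U: "openin X U" for U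
  proof -
    let ?D = "vietoris_diamond \<Z> U"
    have sub: "e ` A \<subseteq> topspace Z" "{B} \<subseteq> topspace Z" using eZ AX topZ B by auto
    have "openin Z ?D" using opZ U by blast
    then have "e ` A \<inter> ?D \<noteq> {} \<longleftrightarrow> {B} \<inter> ?D \<noteq> {}"
      by (rule closure_of_eq_meets[OF B(2) _ sub])
    moreover have "e ` A \<inter> ?D \<noteq> {} \<longleftrightarrow> A \<inter> U \<noteq> {}"
      using e_meets[OF _ U] eZ AX by (fastforce simp: vietoris_diamond_def)
    ultimately show ?thesis using B(1) by (auto simp: vietoris_diamond_def)
  qed
  have "X closure_of A = X closure_of B"
    unfolding closure_of_eq_iff_meets[OF AX BX] using meets by blast
  then have "Y closure_of (f ` A) = Y closure_of (f ` B)"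
    by (metis AX BX cl_image)
  then obtain y where y: "y \<in> topspace Y" "Y closure_of (f ` A) = Y closure_of {y}"
    using B(1) unfolding \<Z>_def by auto
  show "\<exists>!y. y \<in> topspace Y \<and> Y closure_of (f ` A) = Y closure_of {y}"
  proof (rule ex1I[of _ y])
    fix z assume z: "z \<in> topspace Y \<and> Y closure_of (f ` A) = Y closure_of {z}"
    have "z \<in> V \<longleftrightarrow> y \<in> V" if "openin Y V" for V
      using closure_of_eq_meets[of Y "{z}" "{y}" V] y z that by simp
    then show "z = y" using Y y(1) z unfolding t0_space_def by blast
  qed (use y in blast)
qed

end

theory Submission
  imports Defs
begin

text \<open>
  A WD-set is irreducible because a failure of irreducibility is witnessed by two open sets,
  hence by a continuous map into a finite space, and finite spaces are well-filtered.

  The substance is the converse: if \<open>A\<close> is irreducible in a first countable space \<open>X\<close> and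
  \<open>f\<close> maps \<open>X\<close> continuously into a well-filtered space \<open>Y\<close>, then the closure of \<open>f(A)\<close> is the
  closure of a point. When \<open>A\<close> is countable, irreducibility produces a sequence in \<open>A\<close>
  that converges to every point of \<open>A\<close>, since only countably many basic neighbourhoods have to
  be met (\<open>countable_irreducible_sequence\<close>). Such a sequence converges to each of
  its own terms, so the images of its tails are compact; well-filteredness applied to their
  saturations gives a point generic for \<open>f(A)\<close>.

  An uncountable \<open>A\<close> is treated by a Loewenheim-Skolem argument. Irreducibility only asks for
  points in intersections of two basic open sets, so every countable subset of \<open>A\<close> can be
  closed up to a countable irreducible subset of \<open>A\<close> (\<open>countable_irreducible_hull\<close>). Hence \<open>A\<close>
  is the directed union of its countable irreducible subsets. The generic points belonging to
  them form a directed set in the specialization order of \<open>Y\<close>, and well-filteredness, applied a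
  second time to the saturations of these points, provides the generic point for \<open>f(A)\<close>. Both
  applications are instances of \<open>well_filtered_generic_point\<close>.
\<close>

section \<open>Generic points in well-filtered spaces\<close>

definition saturation :: "'a topology \<Rightarrow> 'a set \<Rightarrow> 'a set" where
  "saturation X S = topspace X \<inter> \<Inter>{U. openin X U \<and> S \<subseteq> U}"

lemma saturatedin_saturation: "saturatedin X (saturation X S)"
  unfolding saturatedin_def saturation_def
  by (rule exI[of _ "{U. openin X U \<and> S \<subseteq> U}"]) simp

lemma saturation_subset_open_iff:
  assumes "openin X U" "S \<subseteq> topspace X"
  shows "saturation X S \<subseteq> U \<longleftrightarrow> S \<subseteq> U"
  using assms unfolding saturation_def by blast

lemma compactin_saturation:
  assumes S: "compactin X S"
  shows "compactin X (saturation X S)"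
  unfolding compactin_def
proof (intro conjI allI impI)
  show "saturation X S \<subseteq> topspace X" by (auto simp: saturation_def)
  fix \<U> assume \<U>: "Ball \<U> (openin X) \<and> saturation X S \<subseteq> \<Union>\<U>"
  have SX: "S \<subseteq> topspace X" using S compactin_subset_topspace by blast
  then have "S \<subseteq> \<Union>\<U>" using \<U> unfolding saturation_def by blast
  then obtain \<F> where F: "finite \<F>" "\<F> \<subseteq> \<U>" "S \<subseteq> \<Union>\<F>"
    using S \<U> unfolding compactin_def by meson
  then have "openin X (\<Union>\<F>)" using \<U> by blast
  then have "saturation X S \<subseteq> \<Union>\<F>" using F SX saturation_subset_open_iff by blast
  then show "\<exists>\<F>. finite \<F> \<and> \<F> \<subseteq> \<U> \<and> saturation X S \<subseteq> \<Union>\<F>" using F by blast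
qed

text \<open>
  The saturations of the members of \<open>\<K>\<close> are filtered and none of them lies in the complement of
  the closure of \<open>S\<close>, so some point of that closure belongs to all of them; the last hypothesis
  puts this point into every open set that meets \<open>S\<close>.
\<close>

lemma well_filtered_generic_point:
  assumes wf: "well_filtered_space Y"
    and S: "S \<subseteq> topspace Y"
    and ne: "\<K> \<noteq> {}"
    and K: "\<And>K. K \<in> \<K> \<Longrightarrow> compactin Y K \<and> K \<noteq> {} \<and> K \<subseteq> S"
    and filtered: "\<And>K L. K \<in> \<K> \<Longrightarrow> L \<in> \<K> \<Longrightarrow> \<exists>M\<in>\<K>. M \<subseteq> saturation Y K \<inter> saturation Y L"
    and small: "\<And>V. openin Y V \<Longrightarrow> S \<inter> V \<noteq> {} \<Longrightarrow> \<exists>K\<in>\<K>. K \<subseteq> V"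
  shows "\<exists>c\<in>topspace Y. Y closure_of S = Y closure_of {c}"
proof -
  define U where "U = topspace Y - Y closure_of S"
  have U: "openin Y U" by (simp add: U_def openin_diff)
  have fil: "filtered_family (saturation Y ` \<K>)"
    unfolding filtered_family_def
  proof (intro conjI ballI)
    show "saturation Y ` \<K> \<noteq> {}" using ne by simp
    fix A B assume "A \<in> saturation Y ` \<K>" "B \<in> saturation Y ` \<K>"
    then obtain K L where KL: "K \<in> \<K>" "L \<in> \<K>" "A = saturation Y K" "B = saturation Y L"
      by blast
    then obtain M where M: "M \<in> \<K>" "M \<subseteq> A \<inter> B" using filtered by blast
    have "saturation Y M \<subseteq> A \<inter> B" using M(2) unfolding KL saturation_def by blast
    then show "\<exists>C\<in>saturation Y ` \<K>. C \<subseteq> A \<inter> B" using M by blast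
  qed
  have "\<not> \<Inter>(saturation Y ` \<K>) \<subseteq> U"
  proof
    assume sub: "\<Inter>(saturation Y ` \<K>) \<subseteq> U"
    have "\<exists>A\<in>saturation Y ` \<K>. A \<subseteq> U"
      by (rule well_filtered_spaceD[OF wf fil _ U sub])
        (use K compactin_saturation saturatedin_saturation in blast)
    then obtain L where L: "L \<in> \<K>" "saturation Y L \<subseteq> U" by blast
    then have "L \<subseteq> U" using saturation_subset_open_iff[OF U] K S by blast
    then show False using K[OF L(1)] closure_of_subset[OF S] unfolding U_def by blast
  qed
  then obtain c where c: "\<And>K. K \<in> \<K> \<Longrightarrow> c \<in> saturation Y K" and "c \<notin> U" by blast
  then have cY: "c \<in> topspace Y" using ne unfolding saturation_def by blast
  with \<open>c \<notin> U\<close> have cS: "c \<in> Y closure_of S" by (simp add: U_def)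
  have "S \<inter> V \<noteq> {} \<longleftrightarrow> {c} \<inter> V \<noteq> {}" if V: "openin Y V" for V
  proof
    assume "S \<inter> V \<noteq> {}"
    then obtain L where "L \<in> \<K>" "L \<subseteq> V" using small V by blast
    then show "{c} \<inter> V \<noteq> {}" using c V unfolding saturation_def by blast
  next
    assume "{c} \<inter> V \<noteq> {}"
    then show "S \<inter> V \<noteq> {}" using cS V unfolding closure_of_def by blast
  qed
  then have "Y closure_of S = Y closure_of {c}"
    using closure_of_eq_iff_meets[OF S, of "{c}"] cY by simp
  with cY show ?thesis by blast
qed

text \<open>
  Each tail is compact because an open set containing a single term contains almost all terms.
\<close>

lemma self_convergent_sequence_generic_point:
  assumes wf: "well_filtered_space Y"
    and z: "\<And>m. limitin Y z (z m) sequentially"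
  shows "\<exists>c\<in>topspace Y. Y closure_of (range z) = Y closure_of {c}"
proof -
  have zY: "range z \<subseteq> topspace Y" using z by (auto simp: limitin_def)
  have tail: "\<exists>n. \<forall>m\<ge>n. z m \<in> V" if "openin Y V" "z k \<in> V" for V k
    using z[of k] that by (auto simp: limitin_def eventually_sequentially)
  have compact: "compactin Y (z ` {n..})" for n
    unfolding compactin_def
  proof (intro conjI allI impI)
    show "z ` {n..} \<subseteq> topspace Y" using zY by blast
    fix \<U> assume \<U>: "Ball \<U> (openin Y) \<and> z ` {n..} \<subseteq> \<Union>\<U>"
    then obtain V where V: "V \<in> \<U>" "z n \<in> V" by (metis UnionE atLeast_iff imageI order_refl subsetD)
    then obtain k where k: "\<And>m. k \<le> m \<Longrightarrow> z m \<in> V" using tail \<U> by blast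
    have "finite (z ` {n..<k})" "z ` {n..<k} \<subseteq> \<Union>\<U>" using \<U> by auto
    then obtain \<F> where F: "finite \<F>" "\<F> \<subseteq> \<U>" "z ` {n..<k} \<subseteq> \<Union>\<F>"
      by (rule finite_subset_Union)
    have "z m \<in> \<Union>(insert V \<F>)" if "n \<le> m" for m
    proof (cases "m < k")
      case True
      then have "z m \<in> z ` {n..<k}" using that by simp
      then show ?thesis using F(3) by blast
    qed (use k in auto)
    then have "z ` {n..} \<subseteq> \<Union>(insert V \<F>)" by blast
    then show "\<exists>\<F>. finite \<F> \<and> \<F> \<subseteq> \<U> \<and> z ` {n..} \<subseteq> \<Union>\<F>"
      using F V by (intro exI[of _ "insert V \<F>"]) auto
  qed
  show ?thesis
  proof (rule well_filtered_generic_point[OF wf zY, where \<K> = "range (\<lambda>n. z ` {n..})"])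
    fix K L assume "K \<in> range (\<lambda>n. z ` {n..})" "L \<in> range (\<lambda>n. z ` {n..})"
    then obtain i j where ij: "K = z ` {i..}" "L = z ` {j..}" by blast
    have "z ` {max i j..} \<subseteq> saturation Y K \<inter> saturation Y L"
      using zY unfolding ij saturation_def by auto
    then show "\<exists>M\<in>range (\<lambda>n. z ` {n..}). M \<subseteq> saturation Y K \<inter> saturation Y L" by blast
  next
    fix V assume V: "openin Y V" "range z \<inter> V \<noteq> {}"
    then obtain n where "\<forall>m\<ge>n. z m \<in> V" using tail by blast
    then show "\<exists>K\<in>range (\<lambda>n. z ` {n..}). K \<subseteq> V" by blast
  qed (use compact in auto)
qed

lemma directed_generic_point:
  assumes wf: "well_filtered_space Y"
    and S: "S \<subseteq> topspace Y" "S \<noteq> {}"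
    and dir: "\<And>s t. s \<in> S \<Longrightarrow> t \<in> S \<Longrightarrow>
      \<exists>u\<in>S. \<forall>V. openin Y V \<and> (s \<in> V \<or> t \<in> V) \<longrightarrow> u \<in> V"
  shows "\<exists>c\<in>topspace Y. Y closure_of S = Y closure_of {c}"
proof (rule well_filtered_generic_point[OF wf S(1), where \<K> = "(\<lambda>s. {s}) ` S"])
  fix K L assume "K \<in> (\<lambda>s. {s}) ` S" "L \<in> (\<lambda>s. {s}) ` S"
  then obtain s t where st: "s \<in> S" "t \<in> S" "K = {s}" "L = {t}" by blast
  obtain u where "u \<in> S" and u: "\<forall>V. openin Y V \<and> (s \<in> V \<or> t \<in> V) \<longrightarrow> u \<in> V"
    using dir[OF st(1,2)] by (rule bexE)
  then have uY: "u \<in> topspace Y" using S(1) by blast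
  have "u \<in> saturation Y {s}" using u uY by (simp add: saturation_def)
  moreover have "u \<in> saturation Y {t}" using u uY by (simp add: saturation_def)
  ultimately have "{u} \<subseteq> saturation Y K \<inter> saturation Y L" by (simp add: st)
  then show "\<exists>M\<in>(\<lambda>s. {s}) ` S. M \<subseteq> saturation Y K \<inter> saturation Y L"
    using \<open>u \<in> S\<close> by (rule bexI[OF _ imageI])
next
  fix K assume "K \<in> (\<lambda>s. {s}) ` S"
  then show "compactin Y K \<and> K \<noteq> {} \<and> K \<subseteq> S" using S(1) by auto
next
  fix V assume "S \<inter> V \<noteq> {}"
  then obtain s where "s \<in> S" "s \<in> V" by blast
  then show "\<exists>K\<in>(\<lambda>s. {s}) ` S. K \<subseteq> V" by auto
qed (simp add: S(2))

section \<open>Countable irreducible sets in first countable spaces\<close>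

lemma irreduciblein_meets_Int:
  assumes D: "irreduciblein X D" and U: "openin X U" "D \<inter> U \<noteq> {}"
    and V: "openin X V" "D \<inter> V \<noteq> {}"
  shows "D \<inter> (U \<inter> V) \<noteq> {}"
proof
  assume "D \<inter> (U \<inter> V) = {}"
  then have "D \<subseteq> (topspace X - U) \<union> (topspace X - V)"
    using D by (auto simp: irreduciblein_def)
  then have "D \<subseteq> topspace X - U \<or> D \<subseteq> topspace X - V"
    using U V by (intro irreducibleinD[OF D]) auto
  then show False using U V by blast
qed

lemma first_countable_bases:
  assumes "first_countable X"
  obtains B where "\<And>x. x \<in> topspace X \<Longrightarrow> countable (B x)"
    and "\<And>x V. x \<in> topspace X \<Longrightarrow> V \<in> B x \<Longrightarrow> openin X V \<and> x \<in> V"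
    and "\<And>x U. openin X U \<Longrightarrow> x \<in> U \<Longrightarrow> \<exists>V\<in>B x. V \<subseteq> U"
proof -
  obtain B0 where B0: "\<forall>x\<in>topspace X. countable (B0 x) \<and> (\<forall>V\<in>B0 x. openin X V) \<and>
      (\<forall>U. openin X U \<and> x \<in> U \<longrightarrow> (\<exists>V\<in>B0 x. x \<in> V \<and> V \<subseteq> U))"
    using assms unfolding first_countable_def by metis
  show ?thesis
  proof (rule that[of "\<lambda>x. {V \<in> B0 x. x \<in> V}"])
    fix x assume "x \<in> topspace X"
    then have "countable (B0 x)" using B0 by blast
    then show "countable {V \<in> B0 x. x \<in> V}" by (rule countable_subset[rotated]) blast
  next
    fix x U assume "openin X U" "x \<in> U"
    moreover from this have "x \<in> topspace X" using openin_subset by blast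
    ultimately show "\<exists>V\<in>{V \<in> B0 x. x \<in> V}. V \<subseteq> U" using B0 by blast
  qed (use B0 in blast)
qed

text \<open>
  List the countably many basic neighbourhoods of points of \<open>D\<close>. By irreducibility any initial
  segment of this list has a common point in \<open>D\<close>; these points form the sequence.
\<close>

lemma countable_irreducible_sequence:
  assumes fc: "first_countable X" and D: "irreduciblein X D" "countable D"
  obtains x where "range x \<subseteq> D" and "\<And>d. d \<in> D \<Longrightarrow> limitin X x d sequentially"
proof -
  have DX: "D \<subseteq> topspace X" and Dne: "D \<noteq> {}" using D by (auto simp: irreduciblein_def)
  obtain B where Bc: "\<And>x. x \<in> topspace X \<Longrightarrow> countable (B x)"
    and Bo: "\<And>x V. x \<in> topspace X \<Longrightarrow> V \<in> B x \<Longrightarrow> openin X V \<and> x \<in> V"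
    and Bb: "\<And>x U. openin X U \<Longrightarrow> x \<in> U \<Longrightarrow> \<exists>V\<in>B x. V \<subseteq> U"
    using first_countable_bases[OF fc] by blast
  define \<N> where "\<N> = (\<Union>d\<in>D. B d)"
  have "countable \<N>" unfolding \<N>_def using D(2) Bc DX by (intro countable_UN) auto
  moreover have "\<N> \<noteq> {}"
  proof -
    obtain d where "d \<in> D" using Dne by blast
    then have "\<exists>V\<in>B d. V \<subseteq> topspace X" using Bb[OF openin_topspace] DX by blast
    with \<open>d \<in> D\<close> show ?thesis unfolding \<N>_def by blast
  qed
  ultimately obtain W :: "nat \<Rightarrow> 'a set" where W: "range W = \<N>"
    by (metis range_from_nat_into)
  have W': "openin X (W n) \<and> D \<inter> W n \<noteq> {}" for n
  proof -
    have "W n \<in> \<N>" using W by blast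
    then show ?thesis using Bo DX unfolding \<N>_def by blast
  qed
  have "openin X (\<Inter>i\<le>n. W i) \<and> D \<inter> (\<Inter>i\<le>n. W i) \<noteq> {}" for n
  proof (induction n)
    case 0
    then show ?case using W' by simp
  next
    case (Suc n)
    then show ?case using W'[of "Suc n"] irreduciblein_meets_Int[OF D(1)]
      by (simp add: atMost_Suc openin_Int)
  qed
  then have "\<exists>a. a \<in> D \<and> a \<in> (\<Inter>i\<le>n. W i)" for n by blast
  then obtain x where x: "\<And>n. x n \<in> D" "\<And>n. x n \<in> (\<Inter>i\<le>n. W i)" by metis
  show ?thesis
  proof (rule that[of x])
    fix d assume d: "d \<in> D"
    show "limitin X x d sequentially"
      unfolding limitin_def
    proof (intro conjI allI impI)
      fix U assume "openin X U \<and> d \<in> U"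
      then obtain V where V: "V \<in> B d" "V \<subseteq> U" using Bb by blast
      then have "V \<in> range W" using d unfolding W \<N>_def by blast
      then obtain k where "V = W k" by blast
      then have "x n \<in> U" if "k \<le> n" for n using x(2)[of n] that V by blast
      then show "\<forall>\<^sub>F n in sequentially. x n \<in> U" by (auto simp: eventually_sequentially)
    qed (use d DX in blast)
  qed (use x in blast)
qed

text \<open>
  A Skolem hull: repeatedly add a point of \<open>A \<inter> V \<inter> W\<close> whenever \<open>V\<close> and \<open>W\<close> are basic
  neighbourhoods of points found so far. First countability keeps every stage countable, and two
  open sets that meet the union of the stages contain such \<open>V\<close> and \<open>W\<close>.
\<close>

lemma countable_irreducible_hull:
  assumes fc: "first_countable X" and A: "irreduciblein X A"
    and C: "C \<subseteq> A" "countable C" "C \<noteq> {}"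
  obtains D where "C \<subseteq> D" "D \<subseteq> A" "countable D" "irreduciblein X D"
proof -
  have AX: "A \<subseteq> topspace X" using A by (simp add: irreduciblein_def)
  obtain B where Bc: "\<And>x. x \<in> topspace X \<Longrightarrow> countable (B x)"
    and Bo: "\<And>x V. x \<in> topspace X \<Longrightarrow> V \<in> B x \<Longrightarrow> openin X V \<and> x \<in> V"
    and Bb: "\<And>x U. openin X U \<Longrightarrow> x \<in> U \<Longrightarrow> \<exists>V\<in>B x. V \<subseteq> U"
    using first_countable_bases[OF fc] by blast
  define pick where "pick V W = (SOME a. a \<in> A \<inter> (V \<inter> W))" for V W
  define step where
    "step E = E \<union> (\<Union>d\<in>E. \<Union>e\<in>E. \<Union>V\<in>B d. \<Union>W\<in>B e. {pick V W})" for E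
  define stage where "stage n = (step ^^ n) C" for n
  have pick: "pick V W \<in> A \<inter> (V \<inter> W)" if "V \<in> B d" "W \<in> B e" "d \<in> A" "e \<in> A" for V W d e
  proof -
    have "openin X V" "d \<in> V" "openin X W" "e \<in> W" using Bo that AX by blast+
    then have "A \<inter> (V \<inter> W) \<noteq> {}"
      using irreduciblein_meets_Int[OF A] that by blast
    then show ?thesis unfolding pick_def by (rule some_in_eq[THEN iffD2])
  qed
  have stage: "stage n \<subseteq> A \<and> countable (stage n)" for n
  proof (induction n)
    case 0
    then show ?case using C by (simp add: stage_def)
  next
    case (Suc n)
    have eq: "stage (Suc n) = step (stage n)" by (simp add: stage_def)
    have "countable (B d)" if "d \<in> stage n" for d using that Suc Bc AX by blast
    then have "countable (step (stage n))"
      unfolding step_def using Suc by (intro countable_Un countable_UN) auto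
    moreover have "step (stage n) \<subseteq> A"
    proof
      fix a assume "a \<in> step (stage n)"
      then consider "a \<in> stage n"
        | d e V W where "d \<in> stage n" "e \<in> stage n" "V \<in> B d" "W \<in> B e" "a = pick V W"
        unfolding step_def by blast
      then show "a \<in> A"
        using Suc pick by cases blast+
    qed
    ultimately show ?case unfolding eq by blast
  qed
  have mono: "stage m \<subseteq> stage n" if "m \<le> n" for m n
    by (rule lift_Suc_mono_le[OF _ that]) (auto simp: stage_def step_def)
  define D where "D = (\<Union>n. stage n)"
  have DA: "D \<subseteq> A" using stage by (auto simp: D_def)
  have CD: "C \<subseteq> D"
    unfolding D_def by (rule UN_upper[of 0, THEN subset_trans[rotated]]) (auto simp: stage_def)
  have "irreduciblein X D"
    unfolding irreduciblein_def
  proof (intro conjI allI impI)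
    show "D \<noteq> {}" using CD C(3) by blast
    fix P Q assume PQ: "closedin X P \<and> closedin X Q \<and> D \<subseteq> P \<union> Q"
    show "D \<subseteq> P \<or> D \<subseteq> Q"
    proof (rule ccontr)
      assume "\<not> ?thesis"
      then obtain d e where de: "d \<in> D" "d \<notin> P" "e \<in> D" "e \<notin> Q" by blast
      have "d \<in> topspace X - P" "e \<in> topspace X - Q" using de DA AX by auto
      moreover have "openin X (topspace X - P)" "openin X (topspace X - Q)" using PQ by auto
      ultimately obtain V W where VW: "V \<in> B d" "V \<subseteq> topspace X - P"
          "W \<in> B e" "W \<subseteq> topspace X - Q"
        using Bb by meson
      obtain i j where "d \<in> stage i" "e \<in> stage j" using de unfolding D_def by blast
      then have "d \<in> stage (max i j)" "e \<in> stage (max i j)"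
        using mono[of i "max i j"] mono[of j "max i j"] by auto
      then have "pick V W \<in> step (stage (max i j))" using VW unfolding step_def by blast
      then have "pick V W \<in> stage (Suc (max i j))" by (simp add: stage_def)
      then have "pick V W \<in> D" unfolding D_def by blast
      moreover have "pick V W \<in> V \<inter> W" using pick[OF VW(1,3)] de DA by blast
      ultimately show False using PQ VW by blast
    qed
  qed (use DA AX in blast)
  moreover have "countable D" unfolding D_def using stage by (intro countable_UN) auto
  ultimately show ?thesis using that CD DA by blast
qed

section \<open>WD-sets and irreducible sets\<close>

lemma countable_irreducible_image_generic:
  assumes fc: "first_countable X" and D: "irreduciblein X D" "countable D"
    and wf: "well_filtered_space Y" and f: "continuous_map X Y f"
  shows "\<exists>c\<in>topspace Y. Y closure_of (f ` D) = Y closure_of {c}"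
proof -
  obtain x where xD: "range x \<subseteq> D" and x: "\<And>d. d \<in> D \<Longrightarrow> limitin X x d sequentially"
    using countable_irreducible_sequence[OF fc D] by blast
  have lim: "limitin Y (f \<circ> x) (f d) sequentially" if "d \<in> D" for d
    using continuous_map_limit[OF f x[OF that]] .
  have fD: "f ` D \<subseteq> topspace Y"
    using D f by (auto simp: irreduciblein_def continuous_map_def)
  have "f ` D \<inter> V \<noteq> {} \<longleftrightarrow> range (f \<circ> x) \<inter> V \<noteq> {}" if V: "openin Y V" for V
  proof
    assume "f ` D \<inter> V \<noteq> {}"
    then obtain d where "d \<in> D" "f d \<in> V" by blast
    then have "\<forall>\<^sub>F n in sequentially. (f \<circ> x) n \<in> V" using lim V unfolding limitin_def by blast
    then show "range (f \<circ> x) \<inter> V \<noteq> {}" by (auto simp: eventually_sequentially)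
  qed (use xD in auto)
  then have "Y closure_of (f ` D) = Y closure_of (range (f \<circ> x))"
    using closure_of_eq_iff_meets[OF fD, of "range (f \<circ> x)"] xD fD by fastforce
  moreover have "limitin Y (f \<circ> x) ((f \<circ> x) m) sequentially" for m
    using lim[of "x m"] xD by auto
  then have "\<exists>c\<in>topspace Y. Y closure_of (range (f \<circ> x)) = Y closure_of {c}"
    by (rule self_convergent_sequence_generic_point[OF wf])
  ultimately show ?thesis by simp
qed

text \<open>
  The generic points of the images of the countable irreducible subsets of \<open>A\<close> are directed,
  because two such subsets lie in a third one, and they have the same closure as \<open>f(A)\<close>,
  because each point of \<open>A\<close> lies in such a subset.
\<close>

lemma irreducible_image_generic:
  assumes fc: "first_countable X" and A: "irreduciblein X A"
    and wf: "well_filtered_space Y" and f: "continuous_map X Y f"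
  shows "\<exists>c\<in>topspace Y. Y closure_of (f ` A) = Y closure_of {c}"
proof -
  define \<D> where "\<D> = {D. D \<subseteq> A \<and> countable D \<and> irreduciblein X D}"
  have AX: "A \<subseteq> topspace X" using A by (simp add: irreduciblein_def)
  have fA: "f ` A \<subseteq> topspace Y" using AX f by (auto simp: continuous_map_def)
  have "\<forall>D\<in>\<D>. \<exists>c. c \<in> topspace Y \<and> Y closure_of (f ` D) = Y closure_of {c}"
  proof
    fix D assume "D \<in> \<D>"
    then have "irreduciblein X D" "countable D" by (simp_all add: \<D>_def)
    from countable_irreducible_image_generic[OF fc this wf f]
    show "\<exists>c. c \<in> topspace Y \<and> Y closure_of (f ` D) = Y closure_of {c}" by blast
  qed
  then obtain p where p: "\<And>D. D \<in> \<D> \<Longrightarrow> p D \<in> topspace Y"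
    "\<And>D. D \<in> \<D> \<Longrightarrow> Y closure_of (f ` D) = Y closure_of {p D}" by metis
  have pV: "p D \<in> V \<longleftrightarrow> f ` D \<inter> V \<noteq> {}" if D: "D \<in> \<D>" and V: "openin Y V" for D V
  proof -
    have "f ` D \<subseteq> topspace Y" using D fA unfolding \<D>_def by blast
    then show ?thesis using closure_of_eq_meets[OF p(2)[OF D] V] p(1)[OF D] by simp
  qed
  have hull: "\<exists>D\<in>\<D>. C \<subseteq> D" if C: "C \<subseteq> A" "countable C" "C \<noteq> {}" for C
  proof -
    obtain D where "C \<subseteq> D" "D \<subseteq> A" "countable D" "irreduciblein X D"
      using countable_irreducible_hull[OF fc A C] .
    then have "D \<in> \<D>" by (simp add: \<D>_def)
    with \<open>C \<subseteq> D\<close> show ?thesis by blast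
  qed
  have \<D>ne: "\<D> \<noteq> {}"
  proof -
    obtain a where "a \<in> A" using A by (auto simp: irreduciblein_def)
    then show ?thesis using hull[of "{a}"] by auto
  qed
  have "\<exists>c\<in>topspace Y. Y closure_of (p ` \<D>) = Y closure_of {c}"
  proof (rule directed_generic_point[OF wf])
    fix s t assume "s \<in> p ` \<D>" "t \<in> p ` \<D>"
    then obtain D E where DE: "D \<in> \<D>" "E \<in> \<D>" "s = p D" "t = p E" by blast
    then have "D \<union> E \<subseteq> A" "countable (D \<union> E)" "D \<union> E \<noteq> {}"
      by (auto simp: \<D>_def irreduciblein_def)
    then obtain F where F: "F \<in> \<D>" "D \<union> E \<subseteq> F" using hull by meson
    have "p F \<in> V" if V: "openin Y V" "p D \<in> V \<or> p E \<in> V" for V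
    proof -
      have "f ` D \<inter> V \<noteq> {} \<or> f ` E \<inter> V \<noteq> {}" using V pV DE by blast
      then have "f ` F \<inter> V \<noteq> {}" using F(2) by blast
      then show ?thesis using pV F(1) V(1) by blast
    qed
    then show "\<exists>u\<in>p ` \<D>. \<forall>V. openin Y V \<and> (s \<in> V \<or> t \<in> V) \<longrightarrow> u \<in> V"
      using F(1) DE by blast
  qed (use p \<D>ne in auto)
  moreover have "f ` A \<inter> V \<noteq> {} \<longleftrightarrow> p ` \<D> \<inter> V \<noteq> {}" if V: "openin Y V" for V
  proof
    assume "f ` A \<inter> V \<noteq> {}"
    then obtain a where a: "a \<in> A" "f a \<in> V" by blast
    then obtain D where "D \<in> \<D>" "a \<in> D" using hull[of "{a}"] by auto
    then show "p ` \<D> \<inter> V \<noteq> {}" using pV V a by blast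
  next
    assume "p ` \<D> \<inter> V \<noteq> {}"
    then obtain D where D: "D \<in> \<D>" "p D \<in> V" by blast
    then have "f ` D \<inter> V \<noteq> {}" using pV V by blast
    then show "f ` A \<inter> V \<noteq> {}" using D(1) unfolding \<D>_def by blast
  qed
  then have "Y closure_of (f ` A) = Y closure_of (p ` \<D>)"
    using closure_of_eq_iff_meets[OF fA, of "p ` \<D>"] p(1) by blast
  ultimately show ?thesis by simp
qed

lemma first_countable_irreducible_imp_wd_set:
  assumes "first_countable X" "irreduciblein X A"
  shows "wd_set X A"
  unfolding wd_set_def wd_set_at_def
proof (intro conjI allI impI)
  show "A \<subseteq> topspace X" using assms by (simp add: irreduciblein_def)
  fix Y :: "'a set topology" and f
  assume Y: "t0_space Y \<and> well_filtered_space Y \<and> continuous_map X Y f"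
  then obtain c where c: "c \<in> topspace Y" "Y closure_of (f ` A) = Y closure_of {c}"
    using irreducible_image_generic[OF assms] by blast
  show "\<exists>!y. y \<in> topspace Y \<and> Y closure_of (f ` A) = Y closure_of {y}"
  proof (rule ex1I[of _ c])
    fix z assume z: "z \<in> topspace Y \<and> Y closure_of (f ` A) = Y closure_of {z}"
    have "z \<in> V \<longleftrightarrow> c \<in> V" if "openin Y V" for V
      using closure_of_eq_meets[of Y "{z}" "{c}" V] c z that by simp
    then show "z = c" using Y c(1) z unfolding t0_space_def by blast
  qed (use c in blast)
qed

lemma finite_imp_well_filtered_space:
  assumes "finite (topspace Y)"
  shows "well_filtered_space Y"
  unfolding well_filtered_space_def
proof (intro allI impI)
  fix \<C> U
  assume C: "filtered_family \<C> \<and> (\<forall>K\<in>\<C>. compactin Y K \<and> saturatedin Y K) \<and>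
    openin Y U \<and> \<Inter>\<C> \<subseteq> U"
  then have "\<C> \<subseteq> Pow (topspace Y)" using compactin_subset_topspace by blast
  then have "finite \<C>" using assms by (meson finite_Pow_iff finite_subset)
  moreover have "\<C> \<noteq> {}" using C by (simp add: filtered_family_def)
  ultimately obtain M where M: "M \<in> \<C>" "\<And>K. K \<in> \<C> \<Longrightarrow> K \<subseteq> M \<Longrightarrow> M = K"
    using finite_has_minimal[of \<C>] by metis
  have "M \<subseteq> K" if "K \<in> \<C>" for K
  proof -
    have "\<exists>N\<in>\<C>. N \<subseteq> M \<inter> K" using C M(1) that by (simp add: filtered_family_def)
    then obtain N where N: "N \<in> \<C>" "N \<subseteq> M \<inter> K" by (rule bexE)
    then have "M = N" by (intro M(2)) auto
    with N show ?thesis by simp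
  qed
  then have "M \<subseteq> \<Inter>\<C>" by (rule Inter_greatest)
  moreover have "\<Inter>\<C> \<subseteq> U" using C by simp
  ultimately show "\<exists>K\<in>\<C>. K \<subseteq> U" using M(1) by (meson subset_trans)
qed

text \<open>
  The Alexandrov topology of the inclusion order. On \<^typ>\<open>bool set\<close> it is the square of the
  Sierpinski space, so a continuous map into it amounts to a pair of open sets.
\<close>

definition upset_topology :: "'b set topology" where
  "upset_topology = topology (\<lambda>\<U>. \<forall>s\<in>\<U>. \<forall>t. s \<subseteq> t \<longrightarrow> t \<in> \<U>)"

lemma openin_upset_topology:
  "openin upset_topology \<U> \<longleftrightarrow> (\<forall>s\<in>\<U>. \<forall>t. s \<subseteq> t \<longrightarrow> t \<in> \<U>)"
proof -
  have "istopology (\<lambda>\<U> :: 'a set set. \<forall>s\<in>\<U>. \<forall>t. s \<subseteq> t \<longrightarrow> t \<in> \<U>)"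
    unfolding istopology_def by blast
  then show ?thesis unfolding upset_topology_def by (simp add: topology_inverse')
qed

lemma topspace_upset_topology: "topspace upset_topology = UNIV"
  using openin_subset[of upset_topology UNIV] by (auto simp: openin_upset_topology)

lemma t0_space_upset_topology: "t0_space upset_topology"
  unfolding t0_space_def topspace_upset_topology
proof (intro ballI impI)
  fix s t :: "'a set" assume "s \<noteq> t"
  then obtain b where "b \<in> s \<longleftrightarrow> b \<notin> t" by blast
  moreover have "openin upset_topology {r. b \<in> r}" by (auto simp: openin_upset_topology)
  ultimately show "\<exists>U. openin upset_topology U \<and> (s \<notin> U \<longleftrightarrow> t \<in> U)"
    by (intro exI[of _ "{r. b \<in> r}"]) auto
qed

text \<open>
  Suppose that \<open>A\<close> is covered by the closed sets \<open>B\<close> and \<open>C\<close> but by neither alone, and record for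
  each point which of the two complements contain it. A generic point for the image of \<open>A\<close>
  has to be the top element, which forms an open set; so \<open>A\<close> would contain a point
  outside \<open>B \<union> C\<close>.
\<close>

lemma wd_set_imp_irreduciblein:
  assumes A: "wd_set X A"
  shows "irreduciblein X A"
proof -
  let ?Y = "upset_topology :: bool set topology"
  have AX: "A \<subseteq> topspace X" using A by (simp add: wd_set_def wd_set_at_def)
  have wf: "well_filtered_space ?Y" by (rule finite_imp_well_filtered_space) simp
  have generic: "\<exists>y. ?Y closure_of (f ` A) = ?Y closure_of {y}" if "continuous_map X ?Y f" for f
    using wd_set_imp_wd_set_at[OF A, where 'b = "bool set"] t0_space_upset_topology wf that
    unfolding wd_set_at_def by blast
  show ?thesis
    unfolding irreduciblein_def
  proof (intro conjI allI impI AX)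
    \<comment> \<open>The closure of a point is nonempty, so an empty image has no generic point.\<close>
    have "continuous_map X ?Y (\<lambda>_. {})" by (simp add: topspace_upset_topology)
    then obtain y where "?Y closure_of ((\<lambda>_. {}) ` A) = ?Y closure_of {y}"
      using generic by blast
    moreover have "y \<in> ?Y closure_of {y}" by (simp add: in_closure_of topspace_upset_topology)
    ultimately show "A \<noteq> {}" by auto
  next
    fix B C assume BC: "closedin X B \<and> closedin X C \<and> A \<subseteq> B \<union> C"
    define G where "G b = topspace X - (if b then B else C)" for b
    define f where "f x = {b. x \<in> G b}" for x
    have G: "openin X (G b)" for b using BC by (auto simp: G_def)
    have f: "continuous_map X ?Y f"
      unfolding continuous_map_def
    proof (intro conjI allI impI)
      fix \<U> assume \<U>: "openin ?Y \<U>"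
      show "openin X {x \<in> topspace X. f x \<in> \<U>}"
      proof (subst openin_subopen, intro ballI)
        fix x assume x: "x \<in> {x \<in> topspace X. f x \<in> \<U>}"
        let ?T = "topspace X \<inter> \<Inter>(G ` f x)"
        have "openin X ?T" by (rule openin_Int_Inter) (use G in auto)
        moreover have "x \<in> ?T" using x by (auto simp: f_def)
        moreover have "f x' \<in> \<U>" if "x' \<in> ?T" for x'
        proof -
          have "f x \<subseteq> f x'" using that by (auto simp: f_def)
          then show ?thesis using \<U> x unfolding openin_upset_topology by blast
        qed
        ultimately show "\<exists>T. openin X T \<and> x \<in> T \<and> T \<subseteq> {x \<in> topspace X. f x \<in> \<U>}" by blast
      qed
    qed (simp add: topspace_upset_topology)
    then obtain y where y: "?Y closure_of (f ` A) = ?Y closure_of {y}" using generic by blast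
    have meets: "f ` A \<inter> V \<noteq> {} \<longleftrightarrow> y \<in> V" if "openin ?Y V" for V
      using closure_of_eq_meets[OF y that] by (simp add: topspace_upset_topology)
    show "A \<subseteq> B \<or> A \<subseteq> C"
    proof (rule ccontr)
      assume "\<not> ?thesis"
      then have "A \<inter> G b \<noteq> {}" for b using AX by (cases b) (auto simp: G_def)
      then have "f ` A \<inter> {s. b \<in> s} \<noteq> {}" for b by (auto simp: f_def)
      moreover have "openin ?Y {s. b \<in> s}" for b by (auto simp: openin_upset_topology)
      ultimately have "b \<in> y" for b using meets by blast
      then have "y = UNIV" by blast
      moreover have "openin ?Y {UNIV}" by (auto simp: openin_upset_topology)
      ultimately obtain a where "a \<in> A" "f a = UNIV" using meets by blast
      then have "a \<in> G True" "a \<in> G False" by (auto simp: f_def)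
      then show False using \<open>a \<in> A\<close> BC by (auto simp: G_def)
    qed
  qed
qed

theorem theorem3p12:
  fixes X :: "'a topology"
  assumes "t0_space X"
    and "first_countable X"
  shows "closed_wd_sets X = irr_closed_sets X \<and> well_filterification X = sobrification X"
proof -
  have "closed_wd_sets X = irr_closed_sets X"
    unfolding closed_wd_sets_def irr_closed_sets_def
    using first_countable_irreducible_imp_wd_set[OF assms(2)] wd_set_imp_irreduciblein by blast
  then show ?thesis by (simp add: well_filterification_def sobrification_def)
qed

end
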